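(* Let $A$ be a positive semidefinite matrix, $\|x\|=\sqrt{x^\top Ax}$, and let $\Phi=f+h$, where $f$ is a convex differentiable function that is $1$-smooth and $\mu$-strongly-convex with respect to $\|\cdot\|$ and $h$ is a lower semicontinuous proper convex function. Let $x^*$ be a minimizer of $\Phi$. Let $x^{(0)}$ be a starting point, put $y^{(0)}=z^{(0)}=x^{(0)}$, and for $k=0,1,\dots,T-1$ let $$\alpha_{k+1}=\frac{k+2}{2},\qquad \tau_k=\frac1{\alpha_{k+1}}=\frac{2}{k+2},\qquad x^{(k+1)}=(1-\tau_k)y^{(k)}+\tau_kz^{(k)},$$ let $y^{(k+1)}$ be any point that minimizes $\bar\Phi_{x^{(k+1)}}$ up to additive error $\varepsilon_{k+1}$, i.e. $\bar\Phi_{x^{(k+1)}}(y^{(k+1)})-\min_y\bar\Phi_{x^{(k+1)}}(y)\le\varepsilon_{k+1}$, and let $$z^{(k+1)}=z^{(k)}+\alpha_{k+1}\bigl(y^{(k+1)}-x^{(k+1)}\bigr).$$ Then for any $T>1$, $$\Phi(y^{(T)})-\Phi(x^* )\le\frac{2}{(T+1)^2}\left(\|x^{(0)}-x^*\|+3\sum_{k=1}^{T}k\sqrt{2\varepsilon_k}\right)^2 .$$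
   Context: "Norm" here means seminorm (nonzero vectors may have norm $0$). A convex differentiable $f$ is $L$-smooth w.r.t. $\|\cdot\|$ if $f(y)\le f(x)+\nabla f(x)^\top(y-x)+\frac L2\|y-x\|^2$ for all $x,y$ in its domain, and $\mu$-strongly-convex if $f(y)\ge f(x)+\nabla f(x)^\top(y-x)+\frac\mu2\|y-x\|^2$ for all $x,y$ in its domain. For any $x$, $\bar f_x(u)=f(x)+\nabla f(x)^\top(u-x)+\frac12\|u-x\|^2$ is the quadratic approximation of the $1$-smooth function $f$ around $x$, and $\bar\Phi_x(y)=\bar f_x(y)+h(y)$. A minimizer of $\bar\Phi_x$ is called a proximal mapping of $x$ and is taken to exist. *)

theory Defs
  imports "HOL-Analysis.Analysis"
begin

definition positive_semidefinite :: "real ^ 'n ^ 'n \<Rightarrow> bool" where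
  "positive_semidefinite A \<longleftrightarrow> transpose A = A \<and> (\<forall>x. 0 \<le> x \<bullet> (A *v x))"

text \<open>Only a seminorm in general: nonzero vectors in the kernel of \<open>A\<close> have value \<open>0\<close>.\<close>

definition matrix_norm :: "real ^ 'n ^ 'n \<Rightarrow> real ^ 'n \<Rightarrow> real" where
  "matrix_norm A x = sqrt (x \<bullet> (A *v x))"

definition gradient :: "('a::real_inner \<Rightarrow> real) \<Rightarrow> 'a \<Rightarrow> 'a" where
  "gradient f x = (THE D. GDERIV f x :> D)"

lemma gradient_eqI:
  assumes "GDERIV f x :> D"
  shows "gradient f x = D"
  unfolding gradient_def
proof (rule the_equality)
  fix D' assume "GDERIV f x :> D'"
  with assms have "(\<lambda>h. h \<bullet> D') = (\<lambda>h. h \<bullet> D)"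
    unfolding gderiv_def by (metis has_derivative_unique)
  then show "D' = D"
    by (metis vector_eq_ldot)
qed (fact assms)

lemma GDERIV_gradient:
  fixes f :: "'a::euclidean_space \<Rightarrow> real"
  assumes "f differentiable (at x)"
  shows "GDERIV f x :> gradient f x"
proof -
  obtain f' where f': "(f has_derivative f') (at x)"
    using assms by (auto simp: differentiable_def)
  interpret linear f' by (rule has_derivative_linear[OF f'])
  have "f' h = h \<bullet> adjoint f' 1" for h
    using adjoint_works[OF linear_axioms, of h 1] by simp
  then have "GDERIV f x :> adjoint f' 1"
    using f' unfolding gderiv_def by (metis ext)
  then show ?thesis
    by (metis gradient_eqI)
qed

definition smooth_wrt :: "real \<Rightarrow> ('a::real_inner \<Rightarrow> real) \<Rightarrow> ('a \<Rightarrow> real) \<Rightarrow> bool" where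
  "smooth_wrt L N f \<longleftrightarrow>
     (\<forall>x y. f y \<le> f x + gradient f x \<bullet> (y - x) + L / 2 * (N (y - x))\<^sup>2)"

definition strongly_convex_wrt :: "real \<Rightarrow> ('a::real_inner \<Rightarrow> real) \<Rightarrow> ('a \<Rightarrow> real) \<Rightarrow> bool" where
  "strongly_convex_wrt \<mu> N f \<longleftrightarrow>
     (\<forall>x y. f y \<ge> f x + gradient f x \<bullet> (y - x) + \<mu> / 2 * (N (y - x))\<^sup>2)"

text \<open>The following three notions concern extended-real-valued functions on the whole space,
  where the value \<open>\<infinity>\<close> marks points outside the effective domain. In \<open>ereal_convex\<close>
  the product \<open>0 * \<infinity>\<close> is \<open>0\<close>, so the cases \<open>u = 0\<close> and \<open>v = 0\<close> are trivially
  satisfied; the inequality is meaningful for functions that avoid \<open>-\<infinity>\<close>.\<close>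

definition proper :: "('a \<Rightarrow> ereal) \<Rightarrow> bool" where
  "proper h \<longleftrightarrow> (\<forall>x. h x \<noteq> -\<infinity>) \<and> (\<exists>x. h x \<noteq> \<infinity>)"

definition ereal_convex :: "('a::real_vector \<Rightarrow> ereal) \<Rightarrow> bool" where
  "ereal_convex h \<longleftrightarrow> (\<forall>x y. \<forall>u\<ge>0. \<forall>v\<ge>0. u + v = 1 \<longrightarrow>
     h (u *\<^sub>R x + v *\<^sub>R y) \<le> ereal u * h x + ereal v * h y)"

definition lower_semicontinuous :: "('a::topological_space \<Rightarrow> ereal) \<Rightarrow> bool" where
  "lower_semicontinuous h \<longleftrightarrow> (\<forall>x. h x \<le> Liminf (at x) h)"

definition composite :: "('a \<Rightarrow> real) \<Rightarrow> ('a \<Rightarrow> ereal) \<Rightarrow> 'a \<Rightarrow> ereal" where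
  "composite f h u = ereal (f u) + h u"

definition quad_approx ::
  "('a::real_inner \<Rightarrow> real) \<Rightarrow> ('a \<Rightarrow> real) \<Rightarrow> 'a \<Rightarrow> 'a \<Rightarrow> real" where
  "quad_approx N f x u = f x + gradient f x \<bullet> (u - x) + 1 / 2 * (N (u - x))\<^sup>2"

definition is_minimizer :: "('a \<Rightarrow> ereal) \<Rightarrow> 'a \<Rightarrow> bool" where
  "is_minimizer F x \<longleftrightarrow> is_arg_min F (\<lambda>_. True) x"

text \<open>Minimality up to additive error \<open>\<epsilon>\<close>; the minimum is written as an infimum, with which it
  agrees whenever a minimizer exists.\<close>

definition is_approx_minimizer :: "real \<Rightarrow> ('a \<Rightarrow> ereal) \<Rightarrow> 'a \<Rightarrow> bool" where
  "is_approx_minimizer \<epsilon> F y \<longleftrightarrow> F y - (INF u. F u) \<le> ereal \<epsilon>"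

end

theory Submission
  imports Defs
begin

text \<open>
  Let \<open>p\<close> be the exact proximal point and \<open>e = y - p\<close>. As \<open>\<Phi>bar\<close> grows quadratically away
  from its minimizer, \<open>N e \<le> sqrt (2 * \<epsilon>)\<close>, and the usual proximal inequality holds up to the
  error \<open>\<epsilon> - \<langle>u - y, e\<rangle>\<close>. Taking \<open>u = (1 - \<tau>) y + \<tau> x*\<close> makes the distances \<open>N (z - x*)\<close> telescope.
  Since \<open>(\<alpha> (k + 1))\<^sup>2 - \<alpha> (k + 1) = k (k + 2) / 4 \<le> (k + 1)\<^sup>2 / 4 = (\<alpha> k)\<^sup>2\<close>, the
  potential \<open>W k = 2 * (\<alpha> k)\<^sup>2 * (\<Phi> (y k) - \<Phi> x*) + (N (z k - x*))\<^sup>2\<close> satisfies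
  \<open>W (k + 1) \<le> W k + 2 * a * sqrt (W (k + 1)) + a\<^sup>2\<close> with \<open>a = \<alpha> (k + 1) * sqrt (2 * \<epsilon> (k + 1))\<close>,
  so \<open>sqrt W\<close> increases by at most \<open>3 * a\<close> in each step.
\<close>

section \<open>The seminorm of a positive semidefinite matrix\<close>

lemma matrix_norm_nonneg:
  assumes "positive_semidefinite A"
  shows "0 \<le> matrix_norm A v"
  using assms by (simp add: positive_semidefinite_def matrix_norm_def)

lemma matrix_norm_power2:
  assumes "positive_semidefinite A"
  shows "(matrix_norm A v)\<^sup>2 = v \<bullet> (A *v v)"
  using assms by (simp add: positive_semidefinite_def matrix_norm_def)

lemma matrix_inner_commute:
  fixes A :: "real ^ 'n ^ 'n"
  assumes "positive_semidefinite A"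
  shows "v \<bullet> (A *v w) = w \<bullet> (A *v v)"
proof -
  have "v \<bullet> (A *v w) = (transpose A *v v) \<bullet> w"
    unfolding transpose_matrix_vector dot_lmul_matrix ..
  then show ?thesis
    using assms unfolding positive_semidefinite_def by (metis inner_commute)
qed

lemma matrix_norm_scaleR:
  "matrix_norm A (c *\<^sub>R v) = \<bar>c\<bar> * matrix_norm A v"
proof -
  have "(c *\<^sub>R v) \<bullet> (A *v (c *\<^sub>R v)) = c\<^sup>2 * (v \<bullet> (A *v v))"
    by (simp add: matrix_vector_mult_scaleR power2_eq_square)
  then show ?thesis
    by (simp add: matrix_norm_def real_sqrt_mult)
qed

lemma matrix_norm_add_power2:
  assumes "positive_semidefinite A"
  shows "(matrix_norm A (v + w))\<^sup>2
    = (matrix_norm A v)\<^sup>2 + 2 * (v \<bullet> (A *v w)) + (matrix_norm A w)\<^sup>2"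
  using matrix_inner_commute[OF assms, of v w]
  by (simp add: matrix_norm_power2[OF assms] matrix_vector_right_distrib inner_add)

text \<open>The squared seminorm of \<open>s *\<^sub>R v + t *\<^sub>R w\<close> is a nonnegative
  quadratic form in \<open>s\<close> and \<open>t\<close>. Since the seminorm may vanish on nonzero
  vectors, normalising is impossible in general and the degenerate cases get their own
  \<open>s\<close> and \<open>t\<close>.\<close>

lemma matrix_norm_Cauchy_Schwarz:
  assumes A: "positive_semidefinite A"
  shows "v \<bullet> (A *v w) \<le> matrix_norm A v * matrix_norm A w"
proof -
  let ?N = "matrix_norm A" and ?b = "v \<bullet> (A *v w)"
  have pos: "0 \<le> s\<^sup>2 * (?N v)\<^sup>2 + 2 * s * t * ?b + t\<^sup>2 * (?N w)\<^sup>2" for s t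
    using zero_le_power2[of "?N (s *\<^sub>R v + t *\<^sub>R w)"]
    unfolding matrix_norm_add_power2[OF A]
    by (simp add: matrix_norm_scaleR matrix_vector_mult_scaleR power_mult_distrib mult_ac)
  have nn: "0 \<le> ?N v" "0 \<le> ?N w"
    using matrix_norm_nonneg[OF A] by auto
  have "?b \<le> 0" if "?N v = 0"
  proof -
    \<comment> \<open>With \<open>?N v = 0\<close> the form is
      \<open>2 * s * t * ?b + t\<^sup>2 * (?N w)\<^sup>2\<close>; for \<open>t = ?b\<close> this
      \<open>s\<close> makes it exactly \<open>- (?b\<^sup>2)\<close>.\<close>
    have "0 \<le> - (?b\<^sup>2)"
      using pos[of "- ((?N w)\<^sup>2 + 1) / 2" "?b"] that
      by (simp add: power2_eq_square field_simps)
    then show ?thesis by simp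
  qed
  moreover have "?b \<le> 0" if "?N w = 0"
  proof -
    have "0 \<le> - (?b\<^sup>2)"
      using pos[of "?b" "- ((?N v)\<^sup>2 + 1) / 2"] that
      by (simp add: power2_eq_square field_simps)
    then show ?thesis by simp
  qed
  moreover have "?b \<le> ?N v * ?N w" if "0 < ?N v * ?N w"
  proof -
    \<comment> \<open>These weights make both square terms equal to
      \<open>(?N v * ?N w)\<^sup>2\<close>.\<close>
    have "0 \<le> 2 * (?N v * ?N w) * (?N v * ?N w - ?b)"
      using pos[of "?N w" "- ?N v"] by (simp add: power2_eq_square algebra_simps)
    then show ?thesis
      using that by (simp add: zero_le_mult_iff)
  qed
  ultimately show ?thesis
    using nn by (metis less_eq_real_def mult_eq_0_iff mult_nonneg_nonneg)
qed

lemma matrix_norm_convex_combination: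
  assumes A: "positive_semidefinite A"
  shows "(matrix_norm A ((1 - t) *\<^sub>R v + t *\<^sub>R w))\<^sup>2
    = (1 - t) * (matrix_norm A v)\<^sup>2 + t * (matrix_norm A w)\<^sup>2
      - t * (1 - t) * (matrix_norm A (w - v))\<^sup>2"
  using matrix_inner_commute[OF A, of v w] unfolding matrix_norm_power2[OF A]
  by (simp add: matrix_vector_right_distrib matrix_vector_mult_scaleR
      matrix_vector_mult_diff_distrib inner_add inner_diff algebra_simps power2_eq_square)

section \<open>Quadratic growth of the proximal objective\<close>

lemma quad_approx_convex_combination:
  assumes A: "positive_semidefinite A"
  shows "quad_approx (matrix_norm A) f x ((1 - t) *\<^sub>R p + t *\<^sub>R u)
    = (1 - t) * quad_approx (matrix_norm A) f x p + t * quad_approx (matrix_norm A) f x u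
      - t * (1 - t) / 2 * (matrix_norm A (u - p))\<^sup>2"
proof -
  have eq: "(1 - t) *\<^sub>R p + t *\<^sub>R u - x = (1 - t) *\<^sub>R (p - x) + t *\<^sub>R (u - x)"
    by (simp add: algebra_simps)
  show ?thesis
    unfolding quad_approx_def eq matrix_norm_convex_combination[OF A] inner_add_right
      inner_scaleR_right
    by (simp add: field_simps)
qed

lemma proper_ereal_convexD:
  assumes h: "proper h" "ereal_convex h" and fin: "h v \<noteq> \<infinity>" "h w \<noteq> \<infinity>"
    and t: "0 \<le> t" "t \<le> 1"
  shows "h ((1 - t) *\<^sub>R v + t *\<^sub>R w)
    \<le> ereal ((1 - t) * real_of_ereal (h v) + t * real_of_ereal (h w))"
proof -
  obtain a b where ab: "h v = ereal a" "h w = ereal b"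
    using h(1) fin unfolding proper_def by (metis ereal_cases)
  have "h ((1 - t) *\<^sub>R v + t *\<^sub>R w) \<le> ereal (1 - t) * h v + ereal t * h w"
    using h(2) t unfolding ereal_convex_def by simp
  then show ?thesis
    by (simp add: ab)
qed

lemma composite_eq_ereal:
  assumes "proper h" "h v \<noteq> \<infinity>"
  shows "composite f h v = ereal (f v + real_of_ereal (h v))"
  using assms unfolding proper_def composite_def
  by (metis ereal_cases plus_ereal.simps(1) real_of_ereal.simps(1))

lemma proper_minimizer_finite:
  assumes h: "proper h" and min: "is_minimizer (composite q h) p"
  shows "h p \<noteq> \<infinity>"
proof
  assume p: "h p = \<infinity>"
  obtain v where v: "h v \<noteq> \<infinity>"
    using h unfolding proper_def by blast
  then have "composite q h v < composite q h p"
    unfolding composite_eq_ereal[OF h v] by (simp add: composite_def p)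
  then show False
    using min by (auto simp: is_minimizer_def is_arg_min_def)
qed

text \<open>Comparing \<open>p\<close> with points on the segment towards \<open>u\<close> gains a
  multiple of \<open>t * (1 - t)\<close> from the quadratic part. Dividing by \<open>t\<close> and
  letting \<open>t\<close> tend to 0 leaves the full growth term.\<close>

lemma prox_quadratic_growth:
  assumes A: "positive_semidefinite A" and h: "proper h" "ereal_convex h"
    and min: "is_minimizer (composite (quad_approx (matrix_norm A) f x) h) p"
    and u: "h u \<noteq> \<infinity>"
  shows "quad_approx (matrix_norm A) f x p + real_of_ereal (h p) + (matrix_norm A (u - p))\<^sup>2 / 2
    \<le> quad_approx (matrix_norm A) f x u + real_of_ereal (h u)"
proof -
  let ?q = "quad_approx (matrix_norm A) f x" and ?g = "\<lambda>v. real_of_ereal (h v)"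
  let ?n = "(matrix_norm A (u - p))\<^sup>2"
  have p: "h p \<noteq> \<infinity>"
    by (rule proper_minimizer_finite[OF h(1) min])
  have "?q p + ?g p + (1 - t) * ?n / 2 \<le> ?q u + ?g u" if t: "0 < t" "t < 1" for t
  proof -
    let ?w = "(1 - t) *\<^sub>R p + t *\<^sub>R u"
    have "composite ?q h p \<le> composite ?q h ?w"
      using min by (auto simp: is_minimizer_def is_arg_min_def not_less)
    also have "\<dots> \<le> ereal (?q ?w) + ereal ((1 - t) * ?g p + t * ?g u)"
      unfolding composite_def using proper_ereal_convexD[OF h p u, of t] t
      by (intro add_left_mono) simp
    finally have "?q p + ?g p \<le> ?q ?w + ((1 - t) * ?g p + t * ?g u)"
      unfolding composite_eq_ereal[OF h(1) p] by simp
    then have "t * (?q p + ?g p + (1 - t) * ?n / 2) \<le> t * (?q u + ?g u)"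
      unfolding quad_approx_convex_combination[OF A] by (simp add: algebra_simps)
    then show ?thesis
      using t by simp
  qed
  then have "\<forall>\<^sub>F t in at_right 0. ?q p + ?g p + (1 - t) * ?n / 2 \<le> ?q u + ?g u"
    by (intro eventually_at_rightI[of 0 1]) auto
  moreover have "((\<lambda>t. ?q p + ?g p + (1 - t) * ?n / 2) \<longlongrightarrow> ?q p + ?g p + (1 - 0) * ?n / 2) (at_right 0)"
    by (intro tendsto_intros) simp
  ultimately have "?q p + ?g p + (1 - 0) * ?n / 2 \<le> ?q u + ?g u"
    by (intro tendsto_upperbound) auto
  then show ?thesis by simp
qed

section \<open>Inexact proximal points and one accelerated step\<close>

lemma inexact_prox_finite:
  assumes h: "proper h" and min: "is_minimizer (composite q h) p"
    and y: "is_approx_minimizer \<epsilon> (composite q h) y"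
  shows "h y \<noteq> \<infinity>" and "q y + real_of_ereal (h y) \<le> q p + real_of_ereal (h p) + \<epsilon>"
proof -
  have "(INF u. composite q h u) = composite q h p"
    using min by (intro antisym INF_lower INF_greatest)
      (auto simp: is_minimizer_def is_arg_min_def not_less)
  \<comment> \<open>The subtrahend is finite, so an infinite \<open>h y\<close> would make the gap
    infinite.\<close>
  then have le: "composite q h y - ereal (q p + real_of_ereal (h p)) \<le> ereal \<epsilon>"
    using y unfolding is_approx_minimizer_def
    by (simp add: composite_eq_ereal[OF h proper_minimizer_finite[OF h min]])
  then show fin: "h y \<noteq> \<infinity>"
    by (auto simp: composite_def)
  show "q y + real_of_ereal (h y) \<le> q p + real_of_ereal (h p) + \<epsilon>"
    using le unfolding composite_eq_ereal[OF h fin] by simp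
qed

text \<open>Quadratic growth is used at \<open>y\<close>, to bound \<open>y - p\<close>, and at
  \<open>u\<close>, where replacing the minimal value by that at \<open>y\<close> costs \<epsilon>.
  Re-centring the distance from \<open>p\<close> to \<open>y\<close> produces a cross term, bounded
  by Cauchy-Schwarz.\<close>

lemma inexact_prox_inequality:
  assumes A: "positive_semidefinite A" and h: "proper h" "ereal_convex h"
    and f: "smooth_wrt 1 (matrix_norm A) f"
    and min: "is_minimizer (composite (quad_approx (matrix_norm A) f x) h) p"
    and y: "is_approx_minimizer \<epsilon> (composite (quad_approx (matrix_norm A) f x) h) y"
    and u: "h u \<noteq> \<infinity>"
  shows "f y + real_of_ereal (h y) \<le> f x + gradient f x \<bullet> (u - x) + real_of_ereal (h u)
    + (matrix_norm A (u - x))\<^sup>2 / 2 - (matrix_norm A (y - u))\<^sup>2 / 2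
    + matrix_norm A (y - u) * sqrt (2 * \<epsilon>) + \<epsilon>"
    and "0 \<le> \<epsilon>"
proof -
  let ?N = "matrix_norm A"
  let ?q = "quad_approx ?N f x" and ?g = "\<lambda>v. real_of_ereal (h v)"
  note yfin = inexact_prox_finite[OF h(1) min y]
  note growth = prox_quadratic_growth[OF A h min]
  have e: "(?N (y - p))\<^sup>2 \<le> 2 * \<epsilon>"
    using growth[OF yfin(1)] yfin(2) by simp
  then show "0 \<le> \<epsilon>"
    using zero_le_power2[of "?N (y - p)"] by linarith
  have "?N (y - p) \<le> sqrt (2 * \<epsilon>)"
    using e by (rule real_le_rsqrt)
  then have "(y - u) \<bullet> (A *v (y - p)) \<le> ?N (y - u) * sqrt (2 * \<epsilon>)"
    using matrix_norm_Cauchy_Schwarz[OF A, of "y - u" "y - p"] matrix_norm_nonneg[OF A, of "y - u"]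
    by (meson mult_left_mono order_trans)
  \<comment> \<open>This expands \<open>u - p = - (y - u) + (y - p)\<close>; the last square is
    dropped at the end.\<close>
  moreover have "(?N (u - p))\<^sup>2
      = (?N (y - u))\<^sup>2 - 2 * ((y - u) \<bullet> (A *v (y - p))) + (?N (y - p))\<^sup>2"
    using matrix_inner_commute[OF A, of "u - y" "y - p"]
      matrix_norm_add_power2[OF A, of "-1 *\<^sub>R (y - u)" "y - p"]
    unfolding matrix_norm_scaleR by (simp add: algebra_simps inner_diff)
  moreover have "f y \<le> ?q y"
    using f by (simp add: smooth_wrt_def quad_approx_def)
  moreover have "?q u = f x + gradient f x \<bullet> (u - x) + (?N (u - x))\<^sup>2 / 2"
    by (simp add: quad_approx_def)
  ultimately show "f y + ?g y \<le> f x + gradient f x \<bullet> (u - x) + ?g u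
    + (?N (u - x))\<^sup>2 / 2 - (?N (y - u))\<^sup>2 / 2 + ?N (y - u) * sqrt (2 * \<epsilon>) + \<epsilon>"
    using growth[OF u] yfin(2) zero_le_power2[of "?N (y - p)"] by linarith
qed

text \<open>For \<open>\<alpha> = 1\<close> the point \<open>y0\<close> does not matter and may lie outside the domain of \<open>h\<close>;
  this covers the first step, where nothing is known about \<open>h (x 0)\<close>.\<close>

lemma accelerated_step:
  fixes f :: "real ^ 'n \<Rightarrow> real" and h :: "real ^ 'n \<Rightarrow> ereal" and \<alpha> \<epsilon> :: real
  defines "g \<equiv> \<lambda>v. f v + real_of_ereal (h v)"
  assumes A: "positive_semidefinite A" and h: "proper h" "ereal_convex h"
    and f: "smooth_wrt 1 (matrix_norm A) f" "convex_on UNIV f"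
    and sc: "strongly_convex_wrt \<mu> (matrix_norm A) f" "0 \<le> \<mu>"
    and min: "is_minimizer (composite (quad_approx (matrix_norm A) f x) h) p"
    and y: "is_approx_minimizer \<epsilon> (composite (quad_approx (matrix_norm A) f x) h) y"
    and \<alpha>: "1 \<le> \<alpha>" and s: "h s \<noteq> \<infinity>" and y0: "\<alpha> = 1 \<or> h y0 \<noteq> \<infinity>"
    and x: "x = (1 - 1 / \<alpha>) *\<^sub>R y0 + (1 / \<alpha>) *\<^sub>R z0"
    and z: "z = z0 + \<alpha> *\<^sub>R (y - x)"
  shows "2 * \<alpha>\<^sup>2 * (g y - g s) + (matrix_norm A (z - s))\<^sup>2
    \<le> 2 * (\<alpha>\<^sup>2 - \<alpha>) * (g y0 - g s) + (matrix_norm A (z0 - s))\<^sup>2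
      + 2 * (\<alpha> * sqrt (2 * \<epsilon>)) * matrix_norm A (z - s) + (\<alpha> * sqrt (2 * \<epsilon>))\<^sup>2"
proof -
  let ?N = "matrix_norm A" and ?G = "\<lambda>v. real_of_ereal (h v)"
  \<comment> \<open>Sharing the \<open>y0\<close> part with \<open>x\<close> makes
    \<open>u - x\<close> a multiple of \<open>z0 - s\<close> and \<open>y - u\<close> a multiple of
    \<open>z - s\<close>.\<close>
  define u where "u = (1 - 1 / \<alpha>) *\<^sub>R y0 + (1 / \<alpha>) *\<^sub>R s"
  have \<alpha>0: "0 < \<alpha>" using \<alpha> by simp
  have t: "0 \<le> 1 / \<alpha>" "1 / \<alpha> \<le> 1" using \<alpha> by auto
  have hu: "h u \<le> ereal ((1 - 1 / \<alpha>) * ?G y0 + (1 / \<alpha>) * ?G s)"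
  \<comment> \<open>Here \<open>u = s\<close>, and the default value 0 of
    \<open>real_of_ereal\<close> at infinity is harmless because its coefficient is 0.\<close>
  proof (cases "\<alpha> = 1")
    case True
    then show ?thesis
      using h(1) s by (cases "h s") (auto simp: u_def proper_def)
  next
    case False
    then show ?thesis
      unfolding u_def using y0 by (intro proper_ereal_convexD h s t) auto
  qed
  then have ufin: "h u \<noteq> \<infinity>"
    by auto
  have "f u \<le> (1 - 1 / \<alpha>) * f y0 + (1 / \<alpha>) * f s"
    unfolding u_def using convex_onD[OF f(2), of "1 / \<alpha>" y0 s] t by simp
  moreover have "?G u \<le> (1 - 1 / \<alpha>) * ?G y0 + (1 / \<alpha>) * ?G s"
    using hu ufin h(1) by (cases "h u") (auto simp: proper_def)
  ultimately have gu: "g u \<le> (1 - 1 / \<alpha>) * g y0 + (1 / \<alpha>) * g s"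
    by (simp add: g_def algebra_simps)
  have "f x + gradient f x \<bullet> (u - x) + \<mu> / 2 * (?N (u - x))\<^sup>2 \<le> f u"
    using sc(1) by (simp add: strongly_convex_wrt_def)
  moreover have "0 \<le> \<mu> / 2 * (?N (u - x))\<^sup>2"
    using sc(2) by simp
  ultimately have lin: "f x + gradient f x \<bullet> (u - x) \<le> f u"
    by linarith
  have "u - x = (- (1 / \<alpha>)) *\<^sub>R (z0 - s)"
    by (simp add: u_def x algebra_simps)
  then have ux: "?N (u - x) = ?N (z0 - s) / \<alpha>"
    using \<alpha>0 by (simp only: matrix_norm_scaleR) simp
  have "z - s = \<alpha> *\<^sub>R (y - u)"
    using \<alpha>0 by (simp add: z u_def x algebra_simps)
  then have yu: "?N (y - u) = ?N (z - s) / \<alpha>"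
    using \<alpha>0 by (simp add: matrix_norm_scaleR)
  note prox = inexact_prox_inequality[OF A h f(1) min y ufin]
  have "g y \<le> (1 - 1 / \<alpha>) * g y0 + (1 / \<alpha>) * g s + (?N (z0 - s) / \<alpha>)\<^sup>2 / 2
      - (?N (z - s) / \<alpha>)\<^sup>2 / 2 + ?N (z - s) / \<alpha> * sqrt (2 * \<epsilon>) + \<epsilon>"
    using prox(1) gu lin unfolding ux yu g_def by linarith
  \<comment> \<open>This factor turns the coefficients of both squared distances into 1 in absolute
    value, so that they telescope.\<close>
  then have "2 * \<alpha>\<^sup>2 * g y \<le> 2 * \<alpha>\<^sup>2 * ((1 - 1 / \<alpha>) * g y0 + (1 / \<alpha>) * g s
      + (?N (z0 - s) / \<alpha>)\<^sup>2 / 2 - (?N (z - s) / \<alpha>)\<^sup>2 / 2 + ?N (z - s) / \<alpha> * sqrt (2 * \<epsilon>) + \<epsilon>)"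
    by (intro mult_left_mono) auto
  also have "\<dots> = 2 * (\<alpha>\<^sup>2 - \<alpha>) * g y0 + 2 * \<alpha> * g s + (?N (z0 - s))\<^sup>2 - (?N (z - s))\<^sup>2
      + 2 * (\<alpha> * sqrt (2 * \<epsilon>)) * ?N (z - s) + 2 * \<alpha>\<^sup>2 * \<epsilon>"
    using \<alpha>0 by (simp add: field_simps power2_eq_square)
  also have "2 * \<alpha>\<^sup>2 * \<epsilon> = (\<alpha> * sqrt (2 * \<epsilon>))\<^sup>2"
    using prox(2) by (simp add: power_mult_distrib)
  finally show ?thesis
    by (simp add: algebra_simps)
qed

text \<open>Since \<open>n\<close> is at most \<open>sqrt W\<close>, the hypothesis becomes a
  quadratic inequality in \<open>sqrt W\<close>, solved by completing the square.\<close>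

lemma potential_increment:
  fixes W :: real
  assumes W: "W \<le> B\<^sup>2 + 2 * a * n + a\<^sup>2" and n: "n\<^sup>2 \<le> W" and pos: "0 \<le> B" "0 \<le> a"
  shows "W \<le> (B + 3 * a)\<^sup>2"
proof -
  have W0: "0 \<le> W" using n zero_le_power2[of n] by linarith
  have "2 * a * n \<le> 2 * a * sqrt W"
    using pos(2) real_le_rsqrt[OF n] by (intro mult_left_mono) auto
  then have "(sqrt W - a)\<^sup>2 \<le> B\<^sup>2 + 2 * a\<^sup>2"
    using W W0 by (simp add: power2_diff algebra_simps)
  \<comment> \<open>Rounding \<open>sqrt 2 * a\<close> up to \<open>2 * a\<close> gives the constant
    3 = 1 + 2.\<close>
  also have "\<dots> \<le> (B + 2 * a)\<^sup>2"
    using pos by (simp add: power2_sum power_mult_distrib)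
  finally have "sqrt W - a \<le> B + 2 * a"
    by (rule power2_le_imp_le) (use pos in simp)
  then have "sqrt W \<le> B + 3 * a" by simp
  then have "(sqrt W)\<^sup>2 \<le> (B + 3 * a)\<^sup>2"
    using W0 by (intro power_mono) auto
  then show ?thesis using W0 by simp
qed

section \<open>Convergence rate by induction on the iteration\<close>

theorem theorem8p3:
  fixes A :: "real ^ 'n ^ 'n"
    and f :: "real ^ 'n \<Rightarrow> real"
    and h :: "real ^ 'n \<Rightarrow> ereal"
    and \<mu> :: real
    and xstar :: "real ^ 'n"
    and x y z :: "nat \<Rightarrow> real ^ 'n"
    and \<alpha> \<tau> \<epsilon> :: "nat \<Rightarrow> real"
    and T :: nat
  defines "N \<equiv> matrix_norm A"
    and "\<Phi> \<equiv> composite f h"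
    and "\<Phi>bar \<equiv> \<lambda>p. composite (quad_approx (matrix_norm A) f p) h"
  assumes "positive_semidefinite A"
    and "convex_on UNIV f"
    and "\<forall>p. f differentiable (at p)"
    and "smooth_wrt 1 N f"
    and "0 \<le> \<mu>"
    and "strongly_convex_wrt \<mu> N f"
    and "lower_semicontinuous h"
    and "proper h"
    and "ereal_convex h"
    and prox_exists: "\<forall>p. \<exists>u. is_minimizer (\<Phi>bar p) u"
    and "is_minimizer \<Phi> xstar"
    and "y 0 = x 0"
    and "z 0 = x 0"
    and "\<forall>k<T. \<alpha> (k + 1) = (real k + 2) / 2"
    and "\<forall>k<T. \<tau> k = 1 / \<alpha> (k + 1)"
    and "\<forall>k<T. x (k + 1) = (1 - \<tau> k) *\<^sub>R y k + \<tau> k *\<^sub>R z k"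
    and "\<forall>k<T. is_approx_minimizer (\<epsilon> (k + 1)) (\<Phi>bar (x (k + 1))) (y (k + 1))"
    and "\<forall>k<T. z (k + 1) = z k + \<alpha> (k + 1) *\<^sub>R (y (k + 1) - x (k + 1))"
    and "T > 1"
  shows "\<Phi> (y T) - \<Phi> xstar
    \<le> ereal (2 / (real T + 1)\<^sup>2 *
        (N (x 0 - xstar) + 3 * (\<Sum>k = 1..T. real k * sqrt (2 * \<epsilon> k)))\<^sup>2)"
proof -
  have A: "positive_semidefinite A" by fact
  have h: "proper h" "ereal_convex h" by fact+
  define g where "g v = f v + real_of_ereal (h v)" for v
  define a where "a k = \<alpha> k * sqrt (2 * \<epsilon> k)" for k
  define B where "B k = N (x 0 - xstar) + 3 * (\<Sum>j = 1..k. real j * sqrt (2 * \<epsilon> j))" for k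
  have N0: "0 \<le> N v" for v
    unfolding N_def by (rule matrix_norm_nonneg[OF A])
  have sfin: "h xstar \<noteq> \<infinity>"
    using proper_minimizer_finite[OF h(1)] \<open>is_minimizer \<Phi> xstar\<close> unfolding \<Phi>_def by blast
  have \<Phi>s: "\<Phi> xstar = ereal (g xstar)"
    unfolding \<Phi>_def g_def by (rule composite_eq_ereal[OF h(1) sfin])
  have smin: "g xstar \<le> g v" if "h v \<noteq> \<infinity>" for v
  proof -
    have "\<Phi> xstar \<le> \<Phi> v"
      using \<open>is_minimizer \<Phi> xstar\<close> by (auto simp: is_minimizer_def is_arg_min_def not_less)
    then show ?thesis
      unfolding \<Phi>s unfolding \<Phi>_def composite_eq_ereal[OF h(1) that] by (simp add: g_def)
  qed
  have \<alpha>: "\<alpha> (k + 1) = (real k + 2) / 2" if "k < T" for k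
    using that assms by blast
  have prox: "\<exists>p. is_minimizer (\<Phi>bar (x (k + 1))) p" for k
    using prox_exists by blast
  have approx: "is_approx_minimizer (\<epsilon> (k + 1)) (\<Phi>bar (x (k + 1))) (y (k + 1))" if "k < T" for k
    using that assms by blast
  have yfin: "h (y (k + 1)) \<noteq> \<infinity>" if "k < T" for k
    using prox[of k] approx[OF that] inexact_prox_finite(1)[OF h(1)] unfolding \<Phi>bar_def by blast
  have \<epsilon>: "0 \<le> \<epsilon> (k + 1)" if "k < T" for k
    using prox[of k] approx[OF that] inexact_prox_inequality(2)[OF A h _ _ _ sfin]
      \<open>smooth_wrt 1 N f\<close> unfolding \<Phi>bar_def N_def by blast
  \<comment> \<open>The weights \<open>j\<close> in \<open>B\<close> arise from
    \<open>(k + 2) / 2 \<le> k + 1\<close>.\<close>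
  have a: "0 \<le> a (k + 1)" "a (k + 1) \<le> real (k + 1) * sqrt (2 * \<epsilon> (k + 1))" if "k < T" for k
    unfolding a_def using \<epsilon>[OF that] \<alpha>[OF that]
    by (simp, intro mult_right_mono) auto
  have B0: "0 \<le> B k" if "k \<le> T" for k
  proof -
    have "0 \<le> real j * sqrt (2 * \<epsilon> j)" if "j \<in> {1..k}" for j
      using \<epsilon>[of "j - 1"] that \<open>k \<le> T\<close> by (cases j) auto
    then have "0 \<le> (\<Sum>j = 1..k. real j * sqrt (2 * \<epsilon> j))"
      by (rule sum_nonneg)
    then show ?thesis
      unfolding B_def using N0[of "x 0 - xstar"] by linarith
  qed
  \<comment> \<open>The assumed bound carries only the weight
    \<open>2 * ((\<alpha> (k + 1))\<^sup>2 - \<alpha> (k + 1))\<close>, which is 0 for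
    \<open>k = 0\<close>, whereas the conclusion has the full weight.\<close>
  have step: "2 * (\<alpha> (k + 1))\<^sup>2 * (g (y (k + 1)) - g xstar) + (N (z (k + 1) - xstar))\<^sup>2 \<le> (B (k + 1))\<^sup>2"
    if k: "k < T" and IH: "real k * (real k + 2) / 2 * (g (y k) - g xstar) + (N (z k - xstar))\<^sup>2 \<le> (B k)\<^sup>2"
    for k
  proof -
    let ?W = "2 * (\<alpha> (k + 1))\<^sup>2 * (g (y (k + 1)) - g xstar) + (N (z (k + 1) - xstar))\<^sup>2"
    obtain p where p: "is_minimizer (\<Phi>bar (x (k + 1))) p"
      using prox by blast
    have \<alpha>1: "1 \<le> \<alpha> (k + 1)"
      using \<alpha>[OF k] by simp
    have "?W \<le> 2 * ((\<alpha> (k + 1))\<^sup>2 - \<alpha> (k + 1)) * (g (y k) - g xstar) + (N (z k - xstar))\<^sup>2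
        + 2 * a (k + 1) * N (z (k + 1) - xstar) + (a (k + 1))\<^sup>2"
      unfolding N_def g_def a_def
    proof (rule accelerated_step[OF A h _ \<open>convex_on UNIV f\<close> _ \<open>0 \<le> \<mu>\<close> _ _ \<alpha>1 sfin])
      show "smooth_wrt 1 (matrix_norm A) f" "strongly_convex_wrt \<mu> (matrix_norm A) f"
        using assms unfolding N_def by blast+
      show "is_minimizer (composite (quad_approx (matrix_norm A) f (x (k + 1))) h) p"
        using p unfolding \<Phi>bar_def .
      show "is_approx_minimizer (\<epsilon> (k + 1))
          (composite (quad_approx (matrix_norm A) f (x (k + 1))) h) (y (k + 1))"
        using approx[OF k] unfolding \<Phi>bar_def .
      \<comment> \<open>The first alternative holds for \<open>k = 0\<close>; every later
        \<open>y k\<close> is an approximate minimizer.\<close>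
      show "\<alpha> (k + 1) = 1 \<or> h (y k) \<noteq> \<infinity>"
        using \<alpha>[OF k] yfin[of "k - 1"] k by (cases k) auto
      have "\<tau> k = 1 / \<alpha> (k + 1)" "x (k + 1) = (1 - \<tau> k) *\<^sub>R y k + \<tau> k *\<^sub>R z k"
        using k assms by blast+
      then show "x (k + 1) = (1 - 1 / \<alpha> (k + 1)) *\<^sub>R y k + (1 / \<alpha> (k + 1)) *\<^sub>R z k"
        by metis
      show "z (k + 1) = z k + \<alpha> (k + 1) *\<^sub>R (y (k + 1) - x (k + 1))"
        using k assms by blast
    qed
    also have "2 * ((\<alpha> (k + 1))\<^sup>2 - \<alpha> (k + 1)) = real k * (real k + 2) / 2"
      unfolding \<alpha>[OF k] by (simp add: power2_eq_square field_simps)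
    finally have W: "?W \<le> (B k)\<^sup>2 + 2 * a (k + 1) * N (z (k + 1) - xstar) + (a (k + 1))\<^sup>2"
      using IH by linarith
    \<comment> \<open>Hence the squared distance alone is at most \<open>?W\<close>, as
      \<open>potential_increment\<close> requires.\<close>
    have "0 \<le> 2 * (\<alpha> (k + 1))\<^sup>2 * (g (y (k + 1)) - g xstar)"
      using smin[OF yfin[OF k]] by simp
    then have "?W \<le> (B k + 3 * a (k + 1))\<^sup>2"
      using W B0[of k] a[OF k] k by (intro potential_increment[of _ _ _ "N (z (k + 1) - xstar)"]) auto
    also have "\<dots> \<le> (B (k + 1))\<^sup>2"
      using a[OF k] B0[of k] k by (intro power_mono) (auto simp: B_def)
    finally show ?thesis .
  qed
  have bound: "real k * (real k + 2) / 2 * (g (y k) - g xstar) + (N (z k - xstar))\<^sup>2 \<le> (B k)\<^sup>2"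
    if "k < T" for k
    using that
  proof (induction k)
    case 0
    then show ?case by (simp add: B_def \<open>z 0 = x 0\<close>)
  next
    case (Suc k)
    then have k: "k < T" by simp
    \<comment> \<open>This is \<open>(k + 1) * (k + 3) \<le> (k + 2)\<^sup>2\<close>; optimality of
      \<open>xstar\<close> then allows the weight to be lowered.\<close>
    have "real (k + 1) * (real (k + 1) + 2) / 2 \<le> 2 * (\<alpha> (k + 1))\<^sup>2"
      unfolding \<alpha>[OF k] by (simp add: power2_eq_square field_simps)
    then have "real (k + 1) * (real (k + 1) + 2) / 2 * (g (y (k + 1)) - g xstar)
        \<le> 2 * (\<alpha> (k + 1))\<^sup>2 * (g (y (k + 1)) - g xstar)"
      using smin[OF yfin[OF k]] by (intro mult_right_mono) auto
    then show ?case
      using step[OF k Suc.IH[OF k]] by simp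
  qed
  obtain k where k: "T = k + 1"
    using \<open>T > 1\<close> by (metis less_imp_add_positive add.commute)
  \<comment> \<open>The last iteration uses \<open>step\<close> itself, keeping the full weight
    \<open>(T + 1)\<^sup>2 / 2\<close> that the rate needs.\<close>
  have "2 * (\<alpha> T)\<^sup>2 * (g (y T) - g xstar) \<le> (B T)\<^sup>2"
    using step[OF _ bound, of k] zero_le_power2[of "N (z T - xstar)"] unfolding k by linarith
  moreover have "\<alpha> T = (real T + 1) / 2"
    using \<alpha>[of k] unfolding k by simp
  ultimately have "g (y T) - g xstar \<le> 2 / (real T + 1)\<^sup>2 * (B T)\<^sup>2"
    by (simp add: field_simps power_divide)
  moreover have "\<Phi> (y T) = ereal (g (y T))"
    unfolding \<Phi>_def g_def using yfin[of k] k by (intro composite_eq_ereal[OF h(1)]) simp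
  ultimately show ?thesis
    by (simp add: \<Phi>s B_def)
qed

end
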